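(* Let $G$ be a finite simple graph with at most one isolated vertex. Then the Mycielski construction $M(G)$ of $G$ admits an antimagic orientation.
   Context: All graphs are finite and simple, and are not assumed to be connected. Mycielski construction: for a graph $G$ with $V(G)=\{v_1,\ldots,v_n\}$, $M(G)$ is the graph with vertex set $V(M(G))=\{v_1,\ldots,v_n\}\cup\{u_1,\ldots,u_n\}\cup\{w\}$ (a set of $2n+1$ distinct vertices) and edge set $E(M(G))=E(G)\cup\{v_iu_j \mid v_iv_j\in E(G)\}\cup\{wu_i\mid 1\le i\le n\}$. Here both $v_iu_j$ and $v_ju_i$ are edges whenever $v_iv_j\in E(G)$. Antimagic orientation: let $F$ be a graph, let $D$ be an orientation of $F$ (each edge of $F$ is assigned one of its two directions), and let $\tau:E(F)\to\{1,2,\ldots,|E(F)|\}$ be a bijection. The vertex sum $s_{(D,\tau)}(v)$ of a vertex $v\in V(F)$ is the sum of the labels $\tau(e)$ of all edges $e$ entering $v$ under $D$ minus the sum of the labels $\tau(e)$ of all edges $e$ leaving $v$ under $D$; the vertex sum of an isolated vertex is $0$. The graph $F$ admits an antimagic orientation if there exist an orientation $D$ of $F$ and a bijection $\tau:E(F)\to\{1,2,\ldots,|E(F)|\}$ such that the vertex sums $s_{(D,\tau)}(v)$, $v\in V(F)$, are pairwise distinct. *)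

theory Defs
  imports Main
begin

definition simple_graph :: "'a set \<Rightarrow> 'a set set \<Rightarrow> bool" where
  "simple_graph V E \<longleftrightarrow> finite V \<and> (\<forall>e\<in>E. e \<subseteq> V \<and> card e = 2)"

definition isolated_verts :: "'a set \<Rightarrow> 'a set set \<Rightarrow> 'a set" where
  "isolated_verts V E = {v \<in> V. \<forall>e\<in>E. v \<notin> e}"

(* For a vertex v_i = x of G: Orig x is v_i, Shadow x is u_i, and Apex is w. *)
datatype 'a mvertex = Orig 'a | Shadow 'a | Apex

definition mycielski_verts :: "'a set \<Rightarrow> 'a mvertex set" where
  "mycielski_verts V = Orig ` V \<union> Shadow ` V \<union> {Apex}"

(* In the second set (x, y) ranges over ordered pairs, so an edge {x, y} of G
   contributes both {Orig x, Shadow y} and {Orig y, Shadow x}. *)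
definition mycielski_edges :: "'a set \<Rightarrow> 'a set set \<Rightarrow> 'a mvertex set set" where
  "mycielski_edges V E =
     {{Orig x, Orig y} | x y. {x, y} \<in> E} \<union>
     {{Orig x, Shadow y} | x y. {x, y} \<in> E} \<union>
     {{Apex, Shadow x} | x. x \<in> V}"

lemma simple_graph_mycielski:
  assumes "simple_graph V E"
  shows "simple_graph (mycielski_verts V) (mycielski_edges V E)"
  using assms
  by (fastforce simp: simple_graph_def mycielski_verts_def mycielski_edges_def card_insert_if
      split: if_splits)

(* D is a set of arcs; (x, y) \<in> D is an edge leaving x and entering y. *)
definition orientation :: "'a set set \<Rightarrow> ('a \<times> 'a) set \<Rightarrow> bool" where
  "orientation E D \<longleftrightarrow>
     (\<forall>x y. (x, y) \<in> D \<longrightarrow> {x, y} \<in> E) \<and>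
     (\<forall>x y. {x, y} \<in> E \<longrightarrow> ((x, y) \<in> D) \<noteq> ((y, x) \<in> D))"

definition vertex_sum :: "('a \<times> 'a) set \<Rightarrow> ('a set \<Rightarrow> nat) \<Rightarrow> 'a \<Rightarrow> int" where
  "vertex_sum D \<tau> v =
     (\<Sum>x | (x, v) \<in> D. int (\<tau> {x, v})) - (\<Sum>x | (v, x) \<in> D. int (\<tau> {v, x}))"

definition admits_antimagic_orientation :: "'a set \<Rightarrow> 'a set set \<Rightarrow> bool" where
  "admits_antimagic_orientation V E \<longleftrightarrow>
     (\<exists>D \<tau>. orientation E D \<and> bij_betw \<tau> E {1..card E} \<and> inj_on (vertex_sum D \<tau>) V)"

end

theory Submission imports Defs
begin

text \<open>
  Write \<open>m\<close> and \<open>n\<close> for the numbers of edges and vertices of \<open>G\<close>. Every edge between an original and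
  a shadow is directed towards the shadow, and every edge at the apex is directed away from it. The
  edges of \<open>G\<close> itself are directed along an arbitrary injective ranking \<open>h\<close> of its vertices. The
  edges of \<open>G\<close> receive the labels \<open>1..m\<close>, the original-shadow edges \<open>m+1..3m\<close>, and the apex edges
  \<open>3m+1..3m+n\<close>. All shadows then have positive sums. A non-isolated original \<open>v\<close> has a negative sum:
  for each neighbour \<open>y\<close> the label of the edge from \<open>v\<close> to the shadow of \<open>y\<close> exceeds that of \<open>{v, y}\<close>.
  The possible isolated vertex has sum zero.

  Distinctness within the two classes comes from a greedy rearrangement (\<open>greedy_labels\<close>): if each
  vertex of a class owns a private edge, then the labels of the private edges can be permuted so that
  the sums become distinct, by giving larger labels to vertices whose remaining sums are larger. A
  non-isolated original owns its edge to the shadow of one chosen neighbour, and a shadow owns its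
  apex edge. The apex edges are treated last and do not touch the originals, so the two steps
  do not interfere.

  It remains to keep the apex below all originals. The apex has sum at most \<open>-n(3m+1)\<close>. If \<open>{v, y}\<close>
  has label \<open>k\<close> and leaves \<open>v\<close>, then the edge from \<open>v\<close> to the shadow of \<open>y\<close> initially has label
  \<open>3m+1-k\<close>, so the two together contribute \<open>-(3m+1)\<close> to \<open>v\<close>. Only the private edge may
  break this balance, and then the contribution is still at least \<open>-4m\<close>. As \<open>v\<close> has fewer than \<open>n\<close>
  neighbours, its sum exceeds that of the apex.
\<close>

section \<open>Greedy rearrangement of labels\<close>

text \<open>
  By induction: an element with the largest offset takes the largest label, and so its total
  strictly exceeds every other total, whatever happens to the remaining labels.
\<close>
lemma greedy_labels:
  fixes p :: "'a \<Rightarrow> int" and L :: "nat set"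
  assumes "finite X" "finite L" "card X = card L"
  shows "\<exists>l. bij_betw l X L \<and> inj_on (\<lambda>x. p x + int (l x)) X"
  using assms
proof (induction "card X" arbitrary: X L)
  case 0
  then show ?case by (auto simp: bij_betw_def)
next
  case (Suc c)
  have ne: "X \<noteq> {}" "L \<noteq> {}" using Suc by auto
  have "Max (p ` X) \<in> p ` X" using ne Suc.prems by (intro Max_in) auto
  then obtain a where a: "a \<in> X" "p a = Max (p ` X)" by auto
  have pa: "p x \<le> p a" if "x \<in> X" for x using that a Suc.prems by auto
  define t where "t = Max L"
  have t: "t \<in> L" "\<And>j. j \<in> L \<Longrightarrow> j \<le> t" using ne Suc.prems by (auto simp: t_def)
  have "\<exists>l. bij_betw l (X - {a}) (L - {t}) \<and> inj_on (\<lambda>x. p x + int (l x)) (X - {a})"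
    by (rule Suc.hyps(1)) (use Suc a t in auto)
  then obtain l where l: "bij_betw l (X - {a}) (L - {t})"
    "inj_on (\<lambda>x. p x + int (l x)) (X - {a})" by blast
  define l' where "l' = l(a := t)"
  have "bij_betw l' (X - {a}) (L - {t})"
    using l(1) by (rule bij_betw_cong[THEN iffD1, rotated]) (auto simp: l'_def)
  then have "bij_betw l' ((X - {a}) \<union> {a}) ((L - {t}) \<union> {t})"
    by (rule bij_betw_combine) (auto simp: l'_def bij_betw_def)
  then have bij: "bij_betw l' X L" using a t by (simp add: insert_absorb)
  have small: "p x + int (l' x) < p a + int (l' a)" if "x \<in> X - {a}" for x
  proof -
    have "l x \<in> L - {t}" using l(1) that by (auto simp: bij_betw_def)
    then have "l x < t" using t(2)[of "l x"] by auto
    then show ?thesis using pa[of x] that by (auto simp: l'_def)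
  qed
  have "inj_on (\<lambda>x. p x + int (l' x)) (X - {a})"
    using l(2) by (rule inj_on_cong[THEN iffD1, rotated]) (auto simp: l'_def)
  then have "inj_on (\<lambda>x. p x + int (l' x)) (insert a (X - {a}))"
    using small by (subst inj_on_insert) force
  then show ?case using bij a by (auto simp: insert_absorb)
qed

section \<open>Layered orientations and labellings of the Mycielski graph\<close>

definition nbrs :: "'a set set \<Rightarrow> 'a \<Rightarrow> 'a set" where
  "nbrs E v = {y. {v, y} \<in> E}"

definition darts :: "'a set set \<Rightarrow> ('a \<times> 'a) set" where
  "darts E = {(x, y). {x, y} \<in> E}"

definition layered_arcs :: "'a set \<Rightarrow> 'a set set \<Rightarrow> ('a \<Rightarrow> nat) \<Rightarrow> ('a mvertex \<times> 'a mvertex) set" where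
  "layered_arcs V E h =
     {(Orig x, Orig y) | x y. {x, y} \<in> E \<and> h x < h y} \<union>
     {(Orig x, Shadow y) | x y. {x, y} \<in> E} \<union>
     {(Apex, Shadow x) | x. x \<in> V}"

text \<open>
  An edge is a bare set, so its kind and its endpoints are recovered from the constructors
  that occur in it; the lemmas below give the resulting values on the three kinds of edges.
\<close>
definition layered_label ::
  "('a set \<Rightarrow> nat) \<Rightarrow> ('a \<times> 'a \<Rightarrow> nat) \<Rightarrow> ('a \<Rightarrow> nat) \<Rightarrow> 'a mvertex set \<Rightarrow> nat" where
  "layered_label k g w e =
     (if Apex \<in> e then w (THE x. Shadow x \<in> e)
      else if \<exists>y. Shadow y \<in> e then g (THE x. Orig x \<in> e, THE y. Shadow y \<in> e)
      else k {x. Orig x \<in> e})"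

lemma layered_label_simps [simp]:
  "layered_label k g w {Orig x, Orig y} = k {x, y}"
  "layered_label k g w {Orig x, Shadow y} = g (x, y)"
  "layered_label k g w {Apex, Shadow x} = w x"
proof -
  have "{z. z = x \<or> z = y} = {x, y}" by auto
  then show "layered_label k g w {Orig x, Orig y} = k {x, y}"
    by (simp add: layered_label_def)
qed (auto simp: layered_label_def)

lemma simple_graph_edgeD:
  assumes "simple_graph V E" "{x, y} \<in> E"
  shows "x \<in> V" "y \<in> V" "x \<noteq> y"
  using assms by (auto simp: simple_graph_def card_insert_if split: if_splits)

lemma simple_graph_edgeE:
  assumes "simple_graph V E" "e \<in> E"
  obtains x y where "e = {x, y}" "x \<noteq> y"
  using assms unfolding simple_graph_def by (meson card_2_iff)

lemma simple_graph_finite_edges: "simple_graph V E \<Longrightarrow> finite E"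
  by (rule finite_subset[of _ "Pow V"]) (auto simp: simple_graph_def)

lemma nbrs_subset: "simple_graph V E \<Longrightarrow> nbrs E v \<subseteq> V - {v}"
  using simple_graph_edgeD[of V E v] by (auto simp: nbrs_def)

lemma finite_nbrs: "simple_graph V E \<Longrightarrow> finite (nbrs E v)"
  using nbrs_subset[of V E v] by (auto simp: simple_graph_def intro: finite_subset)

lemma orientation_layered_arcs:
  assumes "simple_graph V E" "inj_on h V"
  shows "orientation (mycielski_edges V E) (layered_arcs V E h)"
proof -
  have hne: "h x \<noteq> h y" if "{x, y} \<in> E" for x y
    using simple_graph_edgeD[OF assms(1) that] assms(2) by (auto dest: inj_onD)
  have "{a, b} \<in> mycielski_edges V E" if "(a, b) \<in> layered_arcs V E h" for a b
    using that unfolding layered_arcs_def mycielski_edges_def by blast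
  moreover have "((a, b) \<in> layered_arcs V E h) \<noteq> ((b, a) \<in> layered_arcs V E h)"
    if "{a, b} \<in> mycielski_edges V E" for a b
  proof (cases a; cases b)
    fix x y assume ab: "a = Orig x" "b = Orig y"
    then have xy: "{x, y} \<in> E" "{y, x} \<in> E"
      using that by (auto simp: mycielski_edges_def doubleton_eq_iff insert_commute)
    then show ?thesis using ab hne[OF xy(1)] by (auto simp: layered_arcs_def)
  qed (use that in \<open>auto simp: mycielski_edges_def layered_arcs_def doubleton_eq_iff\<close>)
  ultimately show ?thesis by (auto simp: orientation_def)
qed

lemma bij_betw_layered_label:
  assumes sg: "simple_graph V E"
    and k: "bij_betw k E {1..m}"
    and g: "bij_betw g (darts E) {m+1..3*m}"
    and w: "bij_betw w V {3*m+1..3*m+n}"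
  shows "bij_betw (layered_label k g w) (mycielski_edges V E) {1..3*m+n}"
proof -
  let ?t = "layered_label k g w"
  define A where "A = {{Orig x, Orig y} | x y. {x, y} \<in> E}"
  define B where "B = {{Orig x, Shadow y} | x y. {x, y} \<in> E}"
  define C where "C = {{Apex, Shadow x} | x. x \<in> V}"
  have "bij_betw ?t A {1..m}"
    unfolding bij_betw_def
  proof
    have "x = x' \<and> y = y' \<or> x = y' \<and> y = x'"
      if "{x, y} \<in> E" "{x', y'} \<in> E" "k {x, y} = k {x', y'}" for x y x' y'
    proof -
      have "{x, y} = {x', y'}" using k that by (auto simp: bij_betw_def dest: inj_onD)
      then show ?thesis by (auto simp: doubleton_eq_iff)
    qed
    then show "inj_on ?t A"
      unfolding A_def by (intro inj_onI) (fastforce simp: doubleton_eq_iff)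
    have "?t ` A = k ` E"
    proof -
      have "k e \<in> ?t ` A" if e: "e \<in> E" for e
      proof -
        obtain x y where "e = {x, y}" using simple_graph_edgeE[OF sg e] .
        then show ?thesis using e
          by (intro image_eqI[of _ _ "{Orig x, Orig y}"]) (auto simp: A_def)
      qed
      then show ?thesis by (auto simp: A_def)
    qed
    then show "?t ` A = {1..m}" using k by (simp add: bij_betw_def)
  qed
  moreover have "bij_betw ?t B {m+1..3*m}"
    unfolding bij_betw_def
  proof
    show "inj_on ?t B"
    proof (rule inj_onI)
      fix e e' assume "e \<in> B" "e' \<in> B" and eq: "?t e = ?t e'"
      then obtain x y x' y' where e: "e = {Orig x, Shadow y}" "(x, y) \<in> darts E"
        "e' = {Orig x', Shadow y'}" "(x', y') \<in> darts E"
        unfolding B_def darts_def by blast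
      then have "(x, y) = (x', y')"
        using eq g inj_onD[of g "darts E" "(x, y)" "(x', y')"] by (simp add: bij_betw_def)
      then show "e = e'" using e by simp
    qed
    have "B = (\<lambda>(x, y). {Orig x, Shadow y}) ` darts E" by (auto simp: B_def darts_def)
    then have "?t ` B = g ` darts E" by (simp add: image_image case_prod_unfold)
    then show "?t ` B = {m+1..3*m}" using g by (simp add: bij_betw_def)
  qed
  moreover have "bij_betw ?t C {3*m+1..3*m+n}"
    unfolding bij_betw_def
  proof
    show "inj_on ?t C"
      using w unfolding C_def bij_betw_def by (intro inj_onI) (auto dest: inj_onD)
    have "C = (\<lambda>x. {Apex, Shadow x}) ` V" by (auto simp: C_def)
    then have "?t ` C = w ` V" by (simp add: image_image)
    then show "?t ` C = {3*m+1..3*m+n}" using w by (simp add: bij_betw_def)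
  qed
  ultimately have "bij_betw ?t (A \<union> B \<union> C) ({1..m} \<union> {m+1..3*m} \<union> {3*m+1..3*m+n})"
    by (intro bij_betw_combine) auto
  moreover have "{1..m} \<union> {m+1..3*m} \<union> {3*m+1..3*m+n} = {1..3*m+n}" by auto
  moreover have "mycielski_edges V E = A \<union> B \<union> C"
    by (simp add: mycielski_edges_def A_def B_def C_def)
  ultimately show ?thesis by simp
qed

definition signed_label :: "('a \<Rightarrow> nat) \<Rightarrow> ('a set \<Rightarrow> nat) \<Rightarrow> 'a \<Rightarrow> 'a \<Rightarrow> int" where
  "signed_label h k v y = (if h y < h v then int (k {v, y}) else - int (k {v, y}))"

lemma vertex_sum_Orig:
  assumes sg: "simple_graph V E" and h: "inj_on h V"
  shows "vertex_sum (layered_arcs V E h) (layered_label k g w) (Orig v) =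
    (\<Sum>y\<in>nbrs E v. signed_label h k v y - int (g (v, y)))"
proof -
  let ?N = "nbrs E v" and ?t = "layered_label k g w"
  have fin: "finite ?N" using finite_nbrs[OF sg] .
  have inset: "{x. (x, Orig v) \<in> layered_arcs V E h} = Orig ` {y \<in> ?N. h y < h v}"
    by (auto simp: layered_arcs_def nbrs_def insert_commute)
  have "h y \<noteq> h v" if "y \<in> ?N" for y
    using that h nbrs_subset[OF sg, of v] simple_graph_edgeD[OF sg, of v y]
    by (auto simp: nbrs_def dest: inj_onD)
  then have outset: "{x. (Orig v, x) \<in> layered_arcs V E h} =
      Orig ` {y \<in> ?N. \<not> h y < h v} \<union> Shadow ` ?N"
    by (force simp: layered_arcs_def nbrs_def)
  have "vertex_sum (layered_arcs V E h) ?t (Orig v) =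
      (\<Sum>y | y \<in> ?N \<and> h y < h v. int (k {y, v}))
      - ((\<Sum>y | y \<in> ?N \<and> \<not> h y < h v. int (k {v, y})) + (\<Sum>y\<in>?N. int (g (v, y))))"
    unfolding vertex_sum_def inset outset
    by (subst sum.union_disjoint) (use fin in \<open>auto simp: sum.reindex inj_on_def\<close>)
  also have "\<dots> = (\<Sum>y\<in>?N. signed_label h k v y) - (\<Sum>y\<in>?N. int (g (v, y)))"
    unfolding signed_label_def
    by (subst sum.If_cases) (use fin in \<open>auto simp: Int_def sum_negf insert_commute\<close>)
  finally show ?thesis by (simp add: sum_subtractf)
qed

lemma vertex_sum_Shadow:
  assumes sg: "simple_graph V E" and "v \<in> V"
  shows "vertex_sum (layered_arcs V E h) (layered_label k g w) (Shadow v) =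
    (\<Sum>x\<in>nbrs E v. int (g (x, v))) + int (w v)"
proof -
  have inset: "{x. (x, Shadow v) \<in> layered_arcs V E h} = insert Apex (Orig ` nbrs E v)"
    using assms by (auto simp: layered_arcs_def nbrs_def insert_commute)
  have outset: "{x. (Shadow v, x) \<in> layered_arcs V E h} = {}"
    by (auto simp: layered_arcs_def)
  show ?thesis
    unfolding vertex_sum_def inset outset
    using finite_nbrs[OF sg, of v] by (subst sum.insert) (auto simp: sum.reindex inj_on_def)
qed

lemma vertex_sum_Apex:
  "vertex_sum (layered_arcs V E h) (layered_label k g w) Apex = - (\<Sum>x\<in>V. int (w x))"
proof -
  have inset: "{x. (x, Apex) \<in> layered_arcs V E h} = {}"
    by (auto simp: layered_arcs_def)
  have outset: "{x. (Apex, x) \<in> layered_arcs V E h} = Shadow ` V"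
    by (auto simp: layered_arcs_def)
  show ?thesis
    unfolding vertex_sum_def inset outset by (simp add: sum.reindex inj_on_def)
qed

section \<open>Labels of the edges between originals and shadows\<close>

text \<open>
  The darts along the orientation by \<open>h\<close> take the upper half \<open>2m+1..3m\<close> in reverse order of
  \<open>k\<close>, so that each of them adds up to \<open>3m+1\<close> with its edge; the opposite darts take \<open>m+1..2m\<close>.
\<close>
definition balanced_label ::
  "('a \<Rightarrow> nat) \<Rightarrow> ('a set \<Rightarrow> nat) \<Rightarrow> nat \<Rightarrow> 'a \<times> 'a \<Rightarrow> nat" where
  "balanced_label h k m = (\<lambda>(x, y). if h x < h y then 3 * m + 1 - k {x, y} else m + k {x, y})"

lemma bij_betw_balanced_label:
  assumes sg: "simple_graph V E" and h: "inj_on h V" and k: "bij_betw k E {1..m}"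
  shows "bij_betw (balanced_label h k m) (darts E) {m+1..3*m}"
proof -
  let ?b = "balanced_label h k m"
  have hne: "h x \<noteq> h y" if "{x, y} \<in> E" for x y
    using simple_graph_edgeD[OF sg that] h by (auto dest: inj_onD)
  have kr: "1 \<le> k e" "k e \<le> m" if "e \<in> E" for e
    using k that by (auto simp: bij_betw_def)
  have low: "?b (x, y) \<le> 2 * m \<longleftrightarrow> \<not> h x < h y" if "{x, y} \<in> E" for x y
    using kr[OF that] by (auto simp: balanced_label_def)
  have "inj_on ?b (darts E)"
  proof (rule inj_onI, clarify)
    fix x y x' y'
    assume d: "(x, y) \<in> darts E" "(x', y') \<in> darts E" and eq: "?b (x, y) = ?b (x', y')"
    have e: "{x, y} \<in> E" "{x', y'} \<in> E" using d by (auto simp: darts_def)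
    have same: "h x < h y \<longleftrightarrow> h x' < h y'" using low[OF e(1)] low[OF e(2)] eq by auto
    then have "k {x, y} = k {x', y'}"
      using eq kr[OF e(1)] kr[OF e(2)] by (auto simp: balanced_label_def split: if_splits)
    then have "{x, y} = {x', y'}" using k e by (auto simp: bij_betw_def dest: inj_onD)
    then show "x = x' \<and> y = y'" using same hne[OF e(1)] by (auto simp: doubleton_eq_iff)
  qed
  moreover have "?b ` darts E = {m+1..3*m}"
  proof (intro equalityI subsetI)
    fix j assume "j \<in> ?b ` darts E"
    then obtain x y where "{x, y} \<in> E" "j = ?b (x, y)" by (auto simp: darts_def)
    then show "j \<in> {m+1..3*m}"
      using kr[of "{x, y}"] by (auto simp: balanced_label_def)
  next
    fix j assume j: "j \<in> {m+1..3*m}"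
    define i where "i = (if j \<le> 2 * m then j - m else 3 * m + 1 - j)"
    have "i \<in> k ` E" using j k by (auto simp: bij_betw_def i_def)
    then obtain e where e: "e \<in> E" "k e = i" by auto
    obtain a b where "e = {a, b}" using simple_graph_edgeE[OF sg e(1)] .
    then obtain x y where xy: "e = {x, y}" "h x < h y"
      using hne[of a b] e(1) by (metis insert_commute linorder_neqE_nat)
    have yx: "{y, x} = e" using xy by auto
    show "j \<in> ?b ` darts E"
    proof (cases "j \<le> 2 * m")
      case True
      have "?b (y, x) = j" using True xy yx e j by (auto simp: balanced_label_def i_def)
      moreover have "(y, x) \<in> darts E" using yx e by (simp add: darts_def)
      ultimately show ?thesis by (metis imageI)
    next
      case False
      have "?b (x, y) = j" using False xy e j by (auto simp: balanced_label_def i_def)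
      moreover have "(x, y) \<in> darts E" using xy e by (simp add: darts_def)
      ultimately show ?thesis by (metis imageI)
    qed
  qed
  ultimately show ?thesis by (simp add: bij_betw_def)
qed

text \<open>
  The private darts \<open>(v, f v)\<close> exchange the labels that the balanced labelling gives to them, so
  the result is still a bijection. Balance survives on all other darts, and the private one
  contributes at least \<open>-3m - m\<close>; this is the source of the lower bound.
\<close>
lemma dart_labels_exist:
  assumes sg: "simple_graph V E" and h: "inj_on h V" and k: "bij_betw k E {1..m}"
  obtains g where "bij_betw g (darts E) {m+1..3*m}"
    and "inj_on (\<lambda>v. \<Sum>y\<in>nbrs E v. signed_label h k v y - int (g (v, y))) {v. nbrs E v \<noteq> {}}"
    and "\<forall>v. nbrs E v \<noteq> {} \<longrightarrow> (\<Sum>y\<in>nbrs E v. signed_label h k v y - int (g (v, y)))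
            \<ge> - (4 * int m + (int (card (nbrs E v)) - 1) * (3 * int m + 1))"
proof -
  let ?b = "balanced_label h k m" and ?c = "signed_label h k"
  define X where "X = {v. nbrs E v \<noteq> {}}"
  define f where "f = (\<lambda>v. SOME y. y \<in> nbrs E v)"
  have f: "f v \<in> nbrs E v" if "v \<in> X" for v
    using that by (auto simp: X_def f_def intro: someI)
  have "X \<subseteq> V" using simple_graph_edgeD[OF sg] by (auto simp: X_def nbrs_def)
  then have finX: "finite X" using sg by (auto simp: simple_graph_def intro: finite_subset)
  define S where "S = (\<lambda>v. (v, f v)) ` X"
  have S: "S \<subseteq> darts E" using f by (auto simp: S_def darts_def nbrs_def)
  have b: "bij_betw ?b (darts E) {m+1..3*m}" by (rule bij_betw_balanced_label[OF sg h k])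
  have bS: "inj_on ?b S" using b S by (auto simp: bij_betw_def intro: inj_on_subset)
  have "card S = card X" unfolding S_def by (rule card_image) (auto simp: inj_on_def)
  then have cardX: "card X = card (?b ` S)" using bS by (simp add: card_image)
  \<comment> \<open>\<open>p\<close> carries a minus sign because the private label of \<open>v\<close> enters its sum negatively.\<close>
  define p where "p = (\<lambda>v. - (?c v (f v) + (\<Sum>y\<in>nbrs E v - {f v}. ?c v y - int (?b (v, y)))))"
  have "\<exists>l. bij_betw l X (?b ` S) \<and> inj_on (\<lambda>x. p x + int (l x)) X"
    by (rule greedy_labels) (use finX cardX in \<open>auto simp: S_def\<close>)
  then obtain l where l: "bij_betw l X (?b ` S)" "inj_on (\<lambda>x. p x + int (l x)) X" by blast
  define g where "g = (\<lambda>(x, y). if (x, y) \<in> S then l x else ?b (x, y))"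
  have gb: "g d = ?b d" if "d \<notin> S" for d using that by (cases d) (auto simp: g_def)
  have gf: "g (v, f v) = l v" if "v \<in> X" for v using that by (auto simp: g_def S_def)
  have gbij: "bij_betw g (darts E) {m+1..3*m}"
  proof -
    have "bij_betw g S (?b ` S)"
    proof (rule bij_betw_cong[THEN iffD1])
      show "bij_betw (l \<circ> fst) S (?b ` S)"
        by (rule bij_betw_trans[OF _ l(1)]) (auto simp: S_def bij_betw_def inj_on_def image_image)
    qed (auto simp: S_def gf)
    moreover have "bij_betw g (darts E - S) (?b ` (darts E - S))"
    proof (rule bij_betw_cong[THEN iffD1])
      show "bij_betw ?b (darts E - S) (?b ` (darts E - S))"
        using b by (auto simp: bij_betw_def intro: inj_on_subset)
    qed (simp add: gb)
    ultimately have "bij_betw g (S \<union> (darts E - S)) (?b ` S \<union> ?b ` (darts E - S))"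
    proof (rule bij_betw_combine)
      show "?b ` S \<inter> ?b ` (darts E - S) = {}"
        using b S by (auto simp: bij_betw_def dest: inj_onD)
    qed
    moreover have "S \<union> (darts E - S) = darts E" using S by auto
    ultimately show ?thesis using b by (simp add: bij_betw_def flip: image_Un)
  qed
  have split: "(\<Sum>y\<in>nbrs E v. ?c v y - int (g (v, y))) =
      (?c v (f v) - int (l v)) + (\<Sum>y\<in>nbrs E v - {f v}. ?c v y - int (?b (v, y)))"
    if "v \<in> X" for v
  proof -
    have "(v, y) \<notin> S" if "y \<noteq> f v" for y using that by (auto simp: S_def)
    then show ?thesis
      using f[OF that] gf[OF that] finite_nbrs[OF sg, of v] gb
      by (subst sum.remove[of _ "f v"]) auto
  qed
  have "inj_on (\<lambda>v. - (p v + int (l v))) X" using l(2) by (auto simp: inj_on_def)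
  moreover have "- (p v + int (l v)) = (\<Sum>y\<in>nbrs E v. ?c v y - int (g (v, y)))"
    if "v \<in> X" for v unfolding split[OF that] p_def by simp
  ultimately have inj: "inj_on (\<lambda>v. \<Sum>y\<in>nbrs E v. ?c v y - int (g (v, y))) X"
    by (simp cong: inj_on_cong)
  have bound: "(\<Sum>y\<in>nbrs E v. ?c v y - int (g (v, y)))
      \<ge> - (4 * int m + (int (card (nbrs E v)) - 1) * (3 * int m + 1))" if v: "v \<in> X" for v
  proof -
    have kr: "1 \<le> k {v, y}" "k {v, y} \<le> m" if "y \<in> nbrs E v" for y
      using k that by (auto simp: bij_betw_def nbrs_def)
    have "(v, f v) \<in> darts E" using f[OF v] by (auto simp: nbrs_def darts_def)
    then have "l v \<le> 3 * m" using gbij gf[OF v] by (force simp: bij_betw_def)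
    then have 1: "?c v (f v) - int (l v) \<ge> - (4 * int m)"
      using kr[OF f[OF v]] by (auto simp: signed_label_def)
    have "- (3 * int m + 1) \<le> ?c v y - int (?b (v, y))" if "y \<in> nbrs E v - {f v}" for y
      using kr[of y] that by (auto simp: signed_label_def balanced_label_def)
    then have "of_nat (card (nbrs E v - {f v})) * - (3 * int m + 1)
        \<le> (\<Sum>y\<in>nbrs E v - {f v}. ?c v y - int (?b (v, y)))"
      by (rule sum_bounded_below)
    moreover have "int (card (nbrs E v - {f v})) = int (card (nbrs E v)) - 1"
    proof -
      have "card (nbrs E v) > 0" using f[OF v] finite_nbrs[OF sg] by (auto simp: card_gt_0_iff)
      then show ?thesis using f[OF v] by (simp add: of_nat_diff)
    qed
    ultimately show ?thesis using 1 unfolding split[OF v] by (simp add: algebra_simps)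
  qed
  show thesis
    by (rule that[OF gbij]) (use inj bound in \<open>auto simp: X_def\<close>)
qed

section \<open>The antimagic orientation\<close>

lemma isolated_verts_unique:
  assumes "simple_graph V E" "card (isolated_verts V E) \<le> 1"
    and "x \<in> V" "y \<in> V" "nbrs E x = {}" "nbrs E y = {}"
  shows "x = y"
proof -
  have "v \<in> isolated_verts V E" if v: "v \<in> V" "nbrs E v = {}" for v
  proof -
    have "v \<notin> e" if e: "e \<in> E" for e
    proof -
      obtain a b where "e = {a, b}" using simple_graph_edgeE[OF assms(1) e] .
      then show ?thesis using v(2) e by (auto simp: nbrs_def insert_commute)
    qed
    then show ?thesis using v(1) by (simp add: isolated_verts_def)
  qed
  moreover have "finite (isolated_verts V E)"
    using assms(1) by (simp add: isolated_verts_def simple_graph_def)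
  ultimately show ?thesis using assms by (auto simp: card_le_Suc0_iff_eq)
qed

theorem theorem3p1:
  fixes V :: "'a set" and E :: "'a set set"
  assumes "simple_graph V E"
    and "card (isolated_verts V E) \<le> 1"
  shows "admits_antimagic_orientation (mycielski_verts V) (mycielski_edges V E)"
proof -
  note sg = assms(1)
  define m n where "m = card E" and "n = card V"
  have finV: "finite V" using sg by (simp add: simple_graph_def)
  obtain h :: "'a \<Rightarrow> nat" where h: "inj_on h V"
    using finite_imp_inj_to_nat_seg[OF finV] by blast
  have "\<exists>k. bij_betw k E {1..m}"
    by (rule finite_same_card_bij) (simp_all add: m_def simple_graph_finite_edges[OF sg])
  then obtain k where k: "bij_betw k E {1..m}" ..
  define c where "c = signed_label h k"
  obtain g where g: "bij_betw g (darts E) {m+1..3*m}"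
    and ginj: "inj_on (\<lambda>v. \<Sum>y\<in>nbrs E v. c v y - int (g (v, y))) {v. nbrs E v \<noteq> {}}"
    and gbound: "\<forall>v. nbrs E v \<noteq> {} \<longrightarrow> (\<Sum>y\<in>nbrs E v. c v y - int (g (v, y)))
            \<ge> - (4 * int m + (int (card (nbrs E v)) - 1) * (3 * int m + 1))"
    unfolding c_def by (rule dart_labels_exist[OF sg h k])
  have "\<exists>w. bij_betw w V {3*m+1..3*m+n} \<and>
      inj_on (\<lambda>v. (\<Sum>x\<in>nbrs E v. int (g (x, v))) + int (w v)) V"
    by (rule greedy_labels) (use finV in \<open>auto simp: n_def\<close>)
  then obtain w where w: "bij_betw w V {3*m+1..3*m+n}"
    and winj: "inj_on (\<lambda>v. (\<Sum>x\<in>nbrs E v. int (g (x, v))) + int (w v)) V" by blast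
  define s where "s = vertex_sum (layered_arcs V E h) (layered_label k g w)"
  have sO: "s (Orig v) = (\<Sum>y\<in>nbrs E v. c v y - int (g (v, y)))" for v
    unfolding s_def c_def by (rule vertex_sum_Orig[OF sg h])
  have sS: "s (Shadow v) = (\<Sum>x\<in>nbrs E v. int (g (x, v))) + int (w v)" if "v \<in> V" for v
    unfolding s_def by (rule vertex_sum_Shadow[OF sg that])
  have wr: "3 * m + 1 \<le> w v" if "v \<in> V" for v using w that by (auto simp: bij_betw_def)
  have pos: "s (Shadow v) > 0" if "v \<in> V" for v
    using wr[OF that] sum_nonneg[of "nbrs E v" "\<lambda>x. int (g (x, v))"] by (simp add: sS[OF that])
  have neg: "s (Orig v) < 0" if "nbrs E v \<noteq> {}" for v
  proof -
    have term_neg: "c v y - int (g (v, y)) < 0" if "y \<in> nbrs E v" for y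
    proof -
      have e: "{v, y} \<in> E" using that by (simp add: nbrs_def)
      then have "k {v, y} \<le> m" using k by (auto simp: bij_betw_def)
      moreover have "g (v, y) \<ge> m + 1" using g e by (force simp: bij_betw_def darts_def)
      ultimately show ?thesis by (auto simp: c_def signed_label_def)
    qed
    have "s (Orig v) < (\<Sum>y\<in>nbrs E v. 0)"
      unfolding sO using finite_nbrs[OF sg] that term_neg by (rule sum_strict_mono)
    then show ?thesis by simp
  qed
  have zero: "s (Orig v) = 0" if "nbrs E v = {}" for v using that by (simp add: sO)
  have "int n * (3 * int m + 1) \<le> (\<Sum>v\<in>V. int (w v))"
    unfolding n_def using wr by (intro sum_bounded_below) force
  then have apex: "s Apex \<le> - (int n * (3 * int m + 1))"
    by (simp add: s_def vertex_sum_Apex)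
  have below: "s Apex < s (Orig v)" if "v \<in> V" "nbrs E v \<noteq> {}" for v
  proof -
    have "card (nbrs E v) \<le> card (V - {v})"
      using nbrs_subset[OF sg] finV by (intro card_mono) auto
    then have "int (card (nbrs E v)) - 1 \<le> int n - 2"
      using that(1) finV card_gt_0_iff[of V] by (auto simp: n_def of_nat_diff)
    \<comment> \<open>This leaves a gap of two terms \<open>3m+1\<close> to the apex, more than the \<open>4m\<close> of the private dart.\<close>
    then have "(int (card (nbrs E v)) - 1) * (3 * int m + 1) \<le> (int n - 2) * (3 * int m + 1)"
      by (rule mult_right_mono) simp
    then show ?thesis using gbound[rule_format, OF that(2)] apex by (simp add: sO algebra_simps)
  qed
  have apex_neg: "s Apex < 0" if "v \<in> V" for v
  proof -
    have "n > 0" using that finV by (auto simp: n_def card_gt_0_iff)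
    then have "int n * (3 * int m + 1) > 0" by simp
    then show ?thesis using apex by linarith
  qed
  have OO: "x = y" if "x \<in> V" "y \<in> V" "s (Orig x) = s (Orig y)" for x y
  proof (cases "nbrs E x = {} \<or> nbrs E y = {}")
    case True
    then have "nbrs E x = {}" "nbrs E y = {}"
      using neg zero that(3) by (metis less_irrefl)+
    then show ?thesis using isolated_verts_unique[OF assms] that by blast
  next
    case False
    then show ?thesis using that inj_onD[OF ginj, of x y] by (simp add: sO)
  qed
  have SS: "x = y" if "x \<in> V" "y \<in> V" "s (Shadow x) = s (Shadow y)" for x y
    using that inj_onD[OF winj, of x y] by (simp add: sS)
  have OS: "s (Orig x) \<noteq> s (Shadow y)" if "y \<in> V" for x y
    using neg[of x] zero[of x] pos[OF that] by (cases "nbrs E x = {}") auto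
  have OA: "s (Orig x) \<noteq> s Apex" if "x \<in> V" for x
    using zero[of x] below[OF that] apex_neg[OF that] by (cases "nbrs E x = {}") auto
  have SA: "s (Shadow x) \<noteq> s Apex" if "x \<in> V" for x
    using pos[OF that] apex_neg[OF that] by linarith
  have "inj_on s (mycielski_verts V)"
    unfolding mycielski_verts_def
    by (rule inj_onI) (use OO SS OS OA SA in \<open>auto dest: sym\<close>)
  moreover have bij: "bij_betw (layered_label k g w) (mycielski_edges V E) {1..3*m+n}"
    by (rule bij_betw_layered_label[OF sg k g w])
  moreover have "card (mycielski_edges V E) = 3 * m + n"
    using bij_betw_same_card[OF bij] by simp
  ultimately show ?thesis
    unfolding admits_antimagic_orientation_def s_def
    using orientation_layered_arcs[OF sg h] by auto
qed

end
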